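(* For every $p\in\mathbb D^n$ and every nonzero $v\in\mathbb C^n$, $$\mathcal H_{\mathbb D^n}(p;v)<2\kappa_{\mathbb D^n}(p;v)=\max_{1\le j\le n}\frac{2|v_j|}{1-|p_j|^2}.$$ Moreover, the path metric $d_{\mathcal H}$ on $\mathbb D^n$ is not complete.
   Context: $\mathbb D=\{z\in\mathbb C:|z|<1\}$. $\kappa_{\mathbb D^n}$ is the Kobayashi–Royden metric of the polydisc, normalized so that $\kappa_{\mathbb D}(z;\xi)=|\xi|/(1-|z|^2)$. The function $\mathcal M:[0,1)\to(0,\infty)$ is given by $\mathcal M(0)=4/\pi$ and, for $0<r<1$, $$\mathcal M(r)=2\int_0^{2\pi}\frac{\cos^2t}{\sqrt{\lambda(r)^2+\cos^2t}}\,\frac{dt}{2\pi},$$ where $\lambda(r)>0$ is the unique positive solution of $$r=\int_0^{2\pi}\frac{\lambda(r)}{\sqrt{\lambda(r)^2+\cos^2t}}\,\frac{dt}{2\pi}.$$ For $p\in\mathbb D^n$ and $v\in\mathbb C^n$, $$\mathcal H_{\mathbb D^n}(p;v)=\max_{1\le j\le n}\frac{2|v_j|}{\mathcal M(|p_j|)},$$ and $d_{\mathcal H}$ is the path distance on $\mathbb D^n$ induced by $\mathcal H_{\mathbb D^n}$ (infimum of $\int\mathcal H_{\mathbb D^n}(\gamma;\gamma')\,ds$ over piecewise $C^1$ curves joining the points). *)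

theory Defs
  imports "HOL-Analysis.Analysis"
begin

definition polydisc :: "(complex ^ 'n) set" where
  "polydisc = {z. \<forall>j. norm (z $ j) < 1}"

text \<open>
  Analytic discs are maps on the unit disc with holomorphic components.
  With this normalization the metric of the unit disc is
  \<open>\<bar>\<xi>\<bar> / (1 - \<bar>z\<bar>\<^sup>2)\<close>.
\<close>

definition kobayashi_royden ::
  "(complex ^ 'n) set \<Rightarrow> complex ^ 'n \<Rightarrow> complex ^ 'n \<Rightarrow> real" where
  "kobayashi_royden \<Omega> p v =
     Inf {norm \<alpha> | \<alpha> :: complex. \<exists>f :: complex \<Rightarrow> complex ^ 'n.
        (\<forall>j. (\<lambda>z. f z $ j) holomorphic_on ball 0 1) \<and> f ` ball 0 1 \<subseteq> \<Omega> \<and>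
        f 0 = p \<and> (\<forall>j. \<alpha> * deriv (\<lambda>z. f z $ j) 0 = v $ j)}"

text \<open>Only meaningful for \<open>0 < r < 1\<close>, where the positive solution exists and is unique.\<close>

definition lam :: "real \<Rightarrow> real" where
  "lam r = (THE l. l > 0 \<and>
     r = 1 / (2 * pi) * integral {0..2 * pi} (\<lambda>t. l / sqrt (l\<^sup>2 + (cos t)\<^sup>2)))"

definition M_fun :: "real \<Rightarrow> real" where
  "M_fun r = (if r = 0 then 4 / pi
     else 2 * (1 / (2 * pi) *
       integral {0..2 * pi} (\<lambda>t. (cos t)\<^sup>2 / sqrt ((lam r)\<^sup>2 + (cos t)\<^sup>2))))"

definition H_metric :: "complex ^ 'n \<Rightarrow> complex ^ 'n \<Rightarrow> real" where
  "H_metric p v = (MAX j. 2 * norm (v $ j) / M_fun (norm (p $ j)))"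

text \<open>
  Piecewise \<open>C\<^sup>1\<close> means \<open>C\<^sup>1\<close> up to the end points (one-sided) on each
  closed interval of a finite partition. The library's
  \<open>piecewise_C1_differentiable_on\<close> allows the derivative to be unbounded near
  the exceptional points, so that the length integral below could fail to exist
  (and the \<open>integral\<close> would then be 0).
\<close>

definition piecewise_C1_path :: "(real \<Rightarrow> 'a :: real_normed_vector) \<Rightarrow> bool" where
  "piecewise_C1_path \<gamma> \<longleftrightarrow>
     (\<exists>(k :: nat) (t :: nat \<Rightarrow> real). t 0 = 0 \<and> t k = 1 \<and>
        (\<forall>i<k. t i < t (Suc i) \<and>
           (\<exists>\<gamma>'. continuous_on {t i..t (Suc i)} \<gamma>' \<and>
              (\<forall>s\<in>{t i..t (Suc i)}.
                 (\<gamma> has_vector_derivative \<gamma>' s) (at s within {t i..t (Suc i)})))))"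

text \<open>At the finitely many break points the value of the integrand is irrelevant.\<close>

definition H_length :: "(real \<Rightarrow> complex ^ 'n) \<Rightarrow> real" where
  "H_length \<gamma> = integral {0..1} (\<lambda>s. H_metric (\<gamma> s) (vector_derivative \<gamma> (at s)))"

text \<open>
  The value 0 off the polydisc is a convention: \<open>Metric_space\<close> requires
  nonnegativity and symmetry of the distance function on the whole type.
\<close>

definition d_H :: "complex ^ 'n \<Rightarrow> complex ^ 'n \<Rightarrow> real" where
  "d_H x y = (if x \<in> polydisc \<and> y \<in> polydisc
     then Inf {H_length \<gamma> | \<gamma>. piecewise_C1_path \<gamma> \<and> path_image \<gamma> \<subseteq> polydisc \<and>
                 pathstart \<gamma> = x \<and> pathfinish \<gamma> = y}
     else 0)"

end

theory Submission
  imports Defs "HOL-Complex_Analysis.Riemann_Mapping"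
begin

text \<open>
  Put \<open>E(l) = \<integral>\<^sub>0\<^sup>2\<^sup>\<pi> sqrt (l\<^sup>2 + cos\<^sup>2 t) dt\<close>. Since \<open>E\<close> is convex and \<open>\<lambda>(r)\<close> solves
  \<open>E'(l) = 2\<pi>r\<close>, one has \<open>\<pi> M(r) = min\<^sub>l (E(l) - 2\<pi>lr)\<close>. As a minimum of affine functions of \<open>r\<close>,
  \<open>M\<close> extends to an even concave function on \<open>(-1,1)\<close>, hence is continuous; the choice \<open>l = 0\<close> gives
  \<open>M \<le> 4/\<pi>\<close>; and the Cauchy--Schwarz bound
  \<open>sqrt (l\<^sup>2 + cos\<^sup>2 t) \<ge> l r + sqrt (1 - r\<^sup>2) \<bar>cos t\<bar>\<close> gives \<open>M(r) \<ge> (4/\<pi>) sqrt (1 - r\<^sup>2) > 1 - r\<^sup>2\<close>.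
  The last inequality compares the two metrics (the Kobayashi--Royden metric is computed by the
  Schwarz--Pick lemma), the upper bound makes \<open>d_H\<close> dominate the Euclidean distance, and
  \<open>M(r) \<ge> (4/\<pi>) sqrt (1 - r\<^sup>2)\<close> shows that the boundary is at finite distance.
\<close>

section \<open>The density function\<close>

text \<open>The cosine keeps its sign between the cuts \<open>pi/2\<close> and
  \<open>3*pi/2\<close>, so the sine is an antiderivative up to sign on each piece; the three
  contributions are 1, 2 and 1.\<close>

lemma integral_abs_cos: "((\<lambda>t. \<bar>cos t\<bar>) has_integral (4::real)) {0..2 * pi}"
proof -
  have 1: "((\<lambda>t. \<bar>cos t\<bar>) has_integral (sin (pi/2) - sin 0)) {0..pi/2}"
    by (rule fundamental_theorem_of_calculus)
       (auto intro!: derivative_eq_intros simp: has_real_derivative_iff_has_vector_derivative[symmetric]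
          abs_of_nonneg[OF cos_ge_zero])
  have neg: "cos t \<le> 0" if "pi/2 \<le> t" "t \<le> 3*pi/2" for t :: real
    using cos_ge_zero[of "t - pi"] that by (simp add: cos_diff)
  have 2: "((\<lambda>t. \<bar>cos t\<bar>) has_integral (- sin (3*pi/2) - (- sin (pi/2)))) {pi/2..3*pi/2}"
    by (rule fundamental_theorem_of_calculus)
       (auto intro!: derivative_eq_intros simp: has_real_derivative_iff_has_vector_derivative[symmetric]
          abs_of_nonpos[OF neg])
  have pos: "cos t \<ge> 0" if "3*pi/2 \<le> t" "t \<le> 2*pi" for t :: real
    using cos_ge_zero[of "t - 2*pi"] that by (simp add: cos_diff)
  have 3: "((\<lambda>t. \<bar>cos t\<bar>) has_integral (sin (2*pi) - sin (3*pi/2))) {3*pi/2..2*pi}"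
    by (rule fundamental_theorem_of_calculus)
       (auto intro!: derivative_eq_intros simp: has_real_derivative_iff_has_vector_derivative[symmetric]
          abs_of_nonneg[OF pos])
  have s: "sin (3*pi/2) = -1"
    using sin_3over2_pi by (simp add: mult.commute)
  show ?thesis
    using has_integral_combine[OF _ _ has_integral_combine[OF _ _ 1 2] 3] s by simp
qed

section \<open>Existence and uniqueness of the parameter \<open>lam r\<close>\<close>

lemma sqrt_sq_cos_pos: "l > 0 \<Longrightarrow> sqrt (l\<^sup>2 + (cos t)\<^sup>2) > 0"
  by (simp add: add_pos_nonneg)

text \<open>Cross-multiplying and squaring reduces the claim to
  \<open>(l * c)\<^sup>2 \<le> (m * c)\<^sup>2\<close>.\<close>

lemma divide_sqrt_mono:
  fixes l m c :: real
  assumes "0 < l" "l \<le> m"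
  shows "l / sqrt (l\<^sup>2 + c\<^sup>2) \<le> m / sqrt (m\<^sup>2 + c\<^sup>2)"
proof -
  have "(l * c)\<^sup>2 \<le> (m * c)\<^sup>2"
    using assms by (simp add: power_mult_distrib mult_right_mono power_mono)
  then have "l\<^sup>2 * (m\<^sup>2 + c\<^sup>2) \<le> m\<^sup>2 * (l\<^sup>2 + c\<^sup>2)"
    by (simp add: algebra_simps power_mult_distrib)
  then have "sqrt (l\<^sup>2 * (m\<^sup>2 + c\<^sup>2)) \<le> sqrt (m\<^sup>2 * (l\<^sup>2 + c\<^sup>2))"
    by simp
  then have "l * sqrt (m\<^sup>2 + c\<^sup>2) \<le> m * sqrt (l\<^sup>2 + c\<^sup>2)"
    using assms by (simp add: real_sqrt_mult)
  moreover have "0 < sqrt (m\<^sup>2 + c\<^sup>2)" "0 < sqrt (l\<^sup>2 + c\<^sup>2)"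
    using assms by (auto simp: add_pos_nonneg)
  ultimately show ?thesis
    by (simp add: field_simps)
qed

lemma continuous_on_lam_integrand:
  "l > 0 \<Longrightarrow> continuous_on A (\<lambda>t. l / sqrt (l\<^sup>2 + (cos t)\<^sup>2))"
  by (intro continuous_intros) (simp add: sum_power2_eq_zero_iff)

text \<open>The difference of the integrands is continuous and nonnegative, so equal integrals would
  force pointwise equality. This fails at \<open>t = 0\<close>, where the cosine is 1. Uniqueness of
  \<open>lam r\<close> rests on this.\<close>

lemma lam_integral_strict_mono:
  assumes "0 < l" "l < m"
  shows "integral {0..2 * pi} (\<lambda>t. l / sqrt (l\<^sup>2 + (cos t)\<^sup>2))
       < integral {0..2 * pi} (\<lambda>t. m / sqrt (m\<^sup>2 + (cos t)\<^sup>2))"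
proof -
  define f where "f \<equiv> \<lambda>l t :: real. l / sqrt (l\<^sup>2 + (cos t)\<^sup>2)"
  have cont: "continuous_on {0..2*pi} (f l)" "continuous_on {0..2*pi} (f m)"
    unfolding f_def using assms by (auto intro: continuous_on_lam_integrand)
  have nn: "f m t - f l t \<ge> 0" for t
    using divide_sqrt_mono[of l m "cos t"] assms by (simp add: f_def)
  have "integral {0..2*pi} (\<lambda>t. f m t - f l t) \<noteq> 0"
  proof
    assume "integral {0..2*pi} (\<lambda>t. f m t - f l t) = 0"
    then have "\<forall>t\<in>{0..2*pi}. f m t - f l t = 0"
      using integral_eq_0_iff[of 0 "2*pi" "\<lambda>t. f m t - f l t"] nn cont
      by (auto intro: continuous_on_diff)
    then have "f m 0 = f l 0" by auto
    then have "(m / sqrt (m\<^sup>2 + 1))\<^sup>2 = (l / sqrt (l\<^sup>2 + 1))\<^sup>2"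
      by (simp add: f_def)
    then have "m\<^sup>2 / (m\<^sup>2 + 1) = l\<^sup>2 / (l\<^sup>2 + 1)"
      by (simp add: power_divide)
    moreover have "m\<^sup>2 + 1 > 0" "l\<^sup>2 + 1 > 0"
      by (simp_all add: add_nonneg_pos)
    ultimately have "m\<^sup>2 = l\<^sup>2"
      by (simp add: field_simps)
    then show False using assms by simp
  qed
  moreover have "integral {0..2*pi} (\<lambda>t. f m t - f l t) \<ge> 0"
    using nn by (intro integral_nonneg integrable_continuous_real continuous_on_diff cont) auto
  moreover have "integral {0..2*pi} (\<lambda>t. f m t - f l t) = integral {0..2*pi} (f m) - integral {0..2*pi} (f l)"
    by (intro integral_diff integrable_continuous_real cont)
  ultimately show ?thesis by (simp add: f_def)
qed

text \<open>Dominated convergence with bound 1. It supplies the lower end point for the intermediate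
  value argument.\<close>

lemma lam_integral_tendsto_0:
  "(\<lambda>n. integral {0..2 * pi} (\<lambda>t. inverse (Suc n) / sqrt ((inverse (Suc n))\<^sup>2 + (cos t)\<^sup>2))) \<longlonglongrightarrow> 0"
proof -
  \<comment> \<open>Where the cosine vanishes the integrand is constantly 1, so the pointwise limit
    is this indicator rather than 0; the set is countable, hence negligible.\<close>
  define g :: "real \<Rightarrow> real" where "g = indicator {t. cos t = 0}"
  define f :: "nat \<Rightarrow> real \<Rightarrow> real"
    where "f \<equiv> \<lambda>n t. inverse (Suc n) / sqrt ((inverse (Suc n))\<^sup>2 + (cos t)\<^sup>2)"
  have *: "(\<lambda>n. integral {0..2*pi} (f n)) \<longlonglongrightarrow> integral {0..2*pi} g"
  proof (rule dominated_convergence(2))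
    show "f n integrable_on {0..2*pi}" for n
      unfolding f_def by (intro integrable_continuous_real continuous_on_lam_integrand) simp
    show "(\<lambda>t. 1::real) integrable_on {0..2*pi}" by (rule integrable_const_ivl)
    show "norm (f n t) \<le> 1" for n t
    proof -
      let ?u = "inverse (real (Suc n))"
      have "?u \<le> sqrt (?u\<^sup>2 + (cos t)\<^sup>2)" by (rule real_le_rsqrt) simp
      moreover have "0 < ?u" by simp
      moreover from this have "0 < sqrt (?u\<^sup>2 + (cos t)\<^sup>2)" by (rule sqrt_sq_cos_pos)
      ultimately have "0 \<le> f n t" "f n t \<le> 1" unfolding f_def
        by (simp_all only: divide_le_eq_1_pos zero_le_divide_iff) auto
      then show ?thesis by simp
    qed
    show "(\<lambda>n. f n t) \<longlonglongrightarrow> g t" for t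
    proof (cases "cos t = 0")
      case True
      then show ?thesis by (simp add: f_def g_def)
    next
      case False
      have "(\<lambda>n. f n t) \<longlonglongrightarrow> 0 / sqrt (0\<^sup>2 + (cos t)\<^sup>2)"
        unfolding f_def using False LIMSEQ_inverse_real_of_nat
        by (intro tendsto_intros) auto
      then show ?thesis using False by (simp add: g_def)
    qed
  qed
  have "negligible {t::real. cos t = 0}"
  proof -
    have "{t::real. cos t = 0} \<subseteq> range (\<lambda>i::int. of_int i * (pi/2))"
      by (auto simp: cos_zero_iff_int)
    then have "countable {t::real. cos t = 0}"
      by (rule countable_subset) simp
    then have "negligible (\<Union>((\<lambda>t. {t}) ` {t::real. cos t = 0}))"
      by (intro negligible_countable_Union) auto
    then show ?thesis by simp
  qed
  then have "(g has_integral 0) {0..2*pi}"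
    by (rule has_integral_spike[OF _ _ has_integral_0]) (auto simp: g_def)
  then show ?thesis using * by (simp add: f_def integral_unique)
qed

text \<open>Intermediate value theorem for the integral as a function of \<open>l\<close>, between a
  small \<open>a\<close> with value below \<open>2 * pi * r\<close> and a \<open>b\<close> with
  value at least \<open>2 * pi * r\<close>.\<close>

lemma lam_exists:
  assumes "0 < r" "r < 1"
  shows "\<exists>l>0. r = 1 / (2 * pi) * integral {0..2 * pi} (\<lambda>t. l / sqrt (l\<^sup>2 + (cos t)\<^sup>2))"
proof -
  define R where "R \<equiv> \<lambda>l. integral {0..2 * pi} (\<lambda>t. l / sqrt (l\<^sup>2 + (cos t)\<^sup>2))"
  have contR: "continuous_on {0<..} R"
  proof -
    have "continuous_on ({0<..} \<times> cbox 0 (2*pi)) (\<lambda>(l, t). l / sqrt (l\<^sup>2 + (cos t)\<^sup>2))"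
      unfolding case_prod_unfold
      by (intro continuous_on_divide continuous_on_fst continuous_on_snd continuous_on_id
           continuous_on_real_sqrt continuous_on_add continuous_on_power continuous_on_cos ballI)
         (auto simp: sum_power2_eq_zero_iff)
    from integral_continuous_on_param[OF this] show ?thesis by (simp add: R_def)
  qed
  have "\<forall>\<^sub>F n in sequentially. R (inverse (real (Suc n))) < 2 * pi * r"
    using lam_integral_tendsto_0 assms unfolding R_def
    by (intro order_tendstoD(2)[of _ 0]) auto
  then obtain n where n: "R (inverse (real (Suc n))) < 2 * pi * r"
    by (auto simp: eventually_sequentially)
  define a where "a = inverse (real (Suc n))"
  have a: "a > 0" "R a < 2 * pi * r" using n by (auto simp: a_def)
  \<comment> \<open>Solves \<open>b / sqrt (b\<^sup>2 + 1) = r\<close>; since the squared cosine is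
    at most 1, the integrand for \<open>b\<close> is then at least \<open>r\<close>
    everywhere.\<close>
  define b where "b = r / sqrt (1 - r\<^sup>2)"
  have r2: "1 - r\<^sup>2 > 0" using assms by (simp add: abs_square_less_1)
  then have b: "b > 0" using assms by (simp add: b_def)
  have b2: "b\<^sup>2 + 1 = 1 / (1 - r\<^sup>2)"
    using r2 by (simp add: b_def power_divide field_simps)
  have bs: "b / sqrt (b\<^sup>2 + 1) = r"
    unfolding b2 using r2 by (simp add: b_def real_sqrt_divide)
  have "integral {0..2*pi} (\<lambda>t. r) \<le> R b"
    unfolding R_def
  proof (intro integral_le integrable_continuous_real continuous_on_lam_integrand b)
    fix t :: real
    have "sqrt (b\<^sup>2 + (cos t)\<^sup>2) \<le> sqrt (b\<^sup>2 + 1)"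
      by (simp add: abs_square_le_1)
    then have "b / sqrt (b\<^sup>2 + 1) \<le> b / sqrt (b\<^sup>2 + (cos t)\<^sup>2)"
      using b sqrt_sq_cos_pos[OF b, of t] by (intro divide_left_mono) (auto intro!: mult_pos_pos simp: add_pos_nonneg)
    then show "r \<le> b / sqrt (b\<^sup>2 + (cos t)\<^sup>2)" using bs by simp
  qed auto
  then have Rb: "2 * pi * r \<le> R b" by simp
  have "a < b"
  proof (rule ccontr)
    assume "\<not> a < b"
    then consider "a = b" | "b < a" by linarith
    then show False
      using a Rb lam_integral_strict_mono[OF b, of a] by cases (auto simp: R_def)
  qed
  then have "\<exists>l\<ge>a. l \<le> b \<and> R l = 2 * pi * r"
    using a Rb by (intro IVT') (auto intro: continuous_on_subset[OF contR])
  then obtain l where "l \<ge> a" "R l = 2 * pi * r" by auto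
  then show ?thesis using a by (intro exI[of _ l]) (auto simp: R_def)
qed

lemma lam_spec:
  assumes "0 < r" "r < 1"
  shows "lam r > 0"
    and "integral {0..2 * pi} (\<lambda>t. lam r / sqrt ((lam r)\<^sup>2 + (cos t)\<^sup>2)) = 2 * pi * r"
proof -
  let ?P = "\<lambda>l. l > 0 \<and> r = 1 / (2 * pi) * integral {0..2 * pi} (\<lambda>t. l / sqrt (l\<^sup>2 + (cos t)\<^sup>2))"
  have "\<exists>!l. ?P l"
  proof (rule ex_ex1I)
    show "\<exists>l. ?P l" using lam_exists[OF assms] by blast
    show "l = m" if "?P l" "?P m" for l m
    proof (rule ccontr)
      assume "l \<noteq> m"
      then consider "l < m" | "m < l" by linarith
      then show False
        using that lam_integral_strict_mono[of l m] lam_integral_strict_mono[of m l] by cases auto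
    qed
  qed
  then have "?P (lam r)" unfolding lam_def by (rule theI')
  then show "lam r > 0"
    and "integral {0..2 * pi} (\<lambda>t. lam r / sqrt ((lam r)\<^sup>2 + (cos t)\<^sup>2)) = 2 * pi * r"
    by (auto simp: field_simps)
qed

section \<open>Variational formula, bounds and continuity of \<open>M_fun\<close>\<close>

text \<open>For \<open>l > 0\<close> this is the perimeter of the ellipse with semi-axes
  \<open>l\<close> and \<open>sqrt (l\<^sup>2 + 1)\<close>, and its derivative in \<open>l\<close>
  is the integral in the equation for \<open>lam\<close>.\<close>

definition cos_energy :: "real \<Rightarrow> real" where
  "cos_energy l = integral {0..2 * pi} (\<lambda>t. sqrt (l\<^sup>2 + (cos t)\<^sup>2))"

lemma integrable_sqrt_sq_cos: "(\<lambda>t::real. sqrt (l\<^sup>2 + (cos t)\<^sup>2)) integrable_on {0..2 * pi}"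
  by (intro integrable_continuous_real continuous_intros)

lemma cos_energy_0: "cos_energy 0 = 4"
  using integral_unique[OF integral_abs_cos] by (simp add: cos_energy_def)

text \<open>
  Convexity of \<open>cos_energy\<close>: the equation defining \<open>lam r\<close> says that the derivative of
  \<open>cos_energy l - 2 * pi * l * r\<close> in \<open>l\<close> vanishes, so its minimum is attained at \<open>lam r\<close>.
\<close>

lemma M_fun_variational:
  assumes "0 \<le> r" "r < 1"
  shows "pi * M_fun r \<le> cos_energy m - 2 * pi * m * r"
    and "\<exists>l\<ge>0. pi * M_fun r = cos_energy l - 2 * pi * l * r"
proof -
  have "pi * M_fun r \<le> cos_energy m - 2 * pi * m * r \<and>
    (\<exists>l\<ge>0. pi * M_fun r = cos_energy l - 2 * pi * l * r)"
  proof (cases "r = 0")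
    case True
    have "cos_energy 0 \<le> cos_energy m"
      unfolding cos_energy_def by (intro integral_le integrable_sqrt_sq_cos) auto
    then show ?thesis using True by (auto simp: M_fun_def cos_energy_0 intro!: exI[of _ 0])
  next
    case False
    define l where "l = lam r"
    have l: "l > 0" and R: "integral {0..2 * pi} (\<lambda>t. l / sqrt (l\<^sup>2 + (cos t)\<^sup>2)) = 2 * pi * r"
      using lam_spec[of r] assms False by (auto simp: l_def)
    define s where "s \<equiv> \<lambda>t. sqrt (l\<^sup>2 + (cos t)\<^sup>2)"
    have s: "s t > 0" "s t * s t = l\<^sup>2 + (cos t)\<^sup>2" for t
      using sqrt_sq_cos_pos[OF l] by (auto simp: s_def)
    have fold_s: "sqrt (l\<^sup>2 + (cos t)\<^sup>2) = s t" for t by (simp add: s_def)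
    have conts: "continuous_on {0..2*pi} s"
      unfolding s_def by (intro continuous_intros)
    have M: "pi * M_fun r = integral {0..2*pi} (\<lambda>t. (cos t)\<^sup>2 / s t)"
      using False by (simp add: M_fun_def l_def s_def)
    have i1: "(\<lambda>t. l / s t) integrable_on {0..2*pi}" "(\<lambda>t. (cos t)\<^sup>2 / s t) integrable_on {0..2*pi}"
      using s(1) by (auto intro!: integrable_continuous_real continuous_intros conts simp: less_imp_neq[symmetric])
    \<comment> \<open>The integrand is the tangent line of
      \<open>sqrt (m\<^sup>2 + (cos t)\<^sup>2)\<close>, as a function of \<open>m\<close>, at the
      point \<open>l\<close>. At \<open>m = l\<close> it gives the energy itself, and for other
      \<open>m\<close> a lower bound.\<close>
    have comb: "integral {0..2*pi} (\<lambda>t. (cos t)\<^sup>2 / s t + m * (l / s t)) = pi * M_fun r + m * (2 * pi * r)" for m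
      using R integral_add[OF i1(2) integrable_on_mult_right[OF i1(1)], of m]
      by (simp only: M s_def integral_mult_right)
    have "cos_energy l = integral {0..2*pi} (\<lambda>t. (cos t)\<^sup>2 / s t + l * (l / s t))"
      unfolding cos_energy_def
    proof (rule integral_cong)
      fix t :: real
      show "sqrt (l\<^sup>2 + (cos t)\<^sup>2) = (cos t)\<^sup>2 / s t + l * (l / s t)"
        using s[of t] unfolding fold_s[of t] by (simp add: field_simps power2_eq_square)
    qed
    moreover have "integral {0..2*pi} (\<lambda>t. (cos t)\<^sup>2 / s t + m * (l / s t)) \<le> cos_energy m"
      unfolding cos_energy_def
    proof (intro integral_le integrable_add integrable_on_mult_right i1 integrable_sqrt_sq_cos)
      fix t :: real
      \<comment> \<open>Lagrange's identity, that is, Cauchy--Schwarz for the vectors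
        \<open>(m, cos t)\<close> and \<open>(l, cos t)\<close>.\<close>
      have "(m * l + (cos t)\<^sup>2)\<^sup>2 + ((m - l) * cos t)\<^sup>2 = (m\<^sup>2 + (cos t)\<^sup>2) * (l\<^sup>2 + (cos t)\<^sup>2)"
        by (simp add: power2_eq_square algebra_simps)
      then have "(m * l + (cos t)\<^sup>2)\<^sup>2 \<le> (m\<^sup>2 + (cos t)\<^sup>2) * (l\<^sup>2 + (cos t)\<^sup>2)"
        using zero_le_power2[of "(m - l) * cos t"] by linarith
      then have "m * l + (cos t)\<^sup>2 \<le> sqrt ((m\<^sup>2 + (cos t)\<^sup>2) * (l\<^sup>2 + (cos t)\<^sup>2))"
        by (rule real_le_rsqrt)
      then have "m * l + (cos t)\<^sup>2 \<le> sqrt (m\<^sup>2 + (cos t)\<^sup>2) * s t"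
        by (simp add: real_sqrt_mult s_def)
      then show "(cos t)\<^sup>2 / s t + m * (l / s t) \<le> sqrt (m\<^sup>2 + (cos t)\<^sup>2)"
        using s[of t] by (simp add: field_simps)
    qed
    ultimately have "cos_energy l = pi * M_fun r + l * (2 * pi * r)"
      "pi * M_fun r + m * (2 * pi * r) \<le> cos_energy m"
      using comb[of l] comb[of m] by linarith+
    then show ?thesis using l by (intro conjI exI[of _ l]) (simp_all add: algebra_simps)
  qed
  then show "pi * M_fun r \<le> cos_energy m - 2 * pi * m * r"
    and "\<exists>l\<ge>0. pi * M_fun r = cos_energy l - 2 * pi * l * r" by auto
qed

lemma M_fun_le:
  assumes "0 \<le> r" "r < 1"
  shows "M_fun r \<le> 4 / pi"
proof -
  have "pi * M_fun r \<le> 4"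
    using M_fun_variational(1)[OF assms, of 0] by (simp add: cos_energy_0)
  then show ?thesis by (simp add: pos_le_divide_eq mult.commute)
qed

text \<open>At the minimizing \<open>l\<close>, Cauchy--Schwarz for the unit vector
  \<open>(r, q)\<close> and \<open>(l, \<bar>cos t\<bar>)\<close> bounds the energy from below;
  after integration the terms containing \<open>l * r\<close> cancel.\<close>

lemma M_fun_ge:
  assumes "0 \<le> r" "r < 1"
  shows "4 / pi * sqrt (1 - r\<^sup>2) \<le> M_fun r"
proof -
  obtain l where l: "l \<ge> 0" "pi * M_fun r = cos_energy l - 2 * pi * l * r"
    using M_fun_variational(2)[OF assms] by blast
  define q where "q = sqrt (1 - r\<^sup>2)"
  have "r\<^sup>2 \<le> 1" using assms by (simp add: abs_square_le_1)
  then have q2: "q\<^sup>2 = 1 - r\<^sup>2" by (simp add: q_def)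
  have int: "((\<lambda>t. l * r + q * \<bar>cos t\<bar>) has_integral 2 * pi * (l * r) + q * 4) {0..2*pi}"
    using has_integral_const_real[of "l * r" 0 "2 * pi"] integral_abs_cos
    by (intro has_integral_add has_integral_mult_right) auto
  have "2 * pi * (l * r) + q * 4 \<le> cos_energy l"
    unfolding cos_energy_def
  proof (rule has_integral_le[OF int integrable_integral[OF integrable_sqrt_sq_cos]])
    fix t :: real
    have "(l * r + q * \<bar>cos t\<bar>)\<^sup>2 + (l * q - r * \<bar>cos t\<bar>)\<^sup>2 = (r\<^sup>2 + q\<^sup>2) * (l\<^sup>2 + (cos t)\<^sup>2)"
      by (simp add: power2_eq_square algebra_simps flip: abs_mult)
    also have "\<dots> = l\<^sup>2 + (cos t)\<^sup>2" using q2 by simp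
    finally have "(l * r + q * \<bar>cos t\<bar>)\<^sup>2 \<le> l\<^sup>2 + (cos t)\<^sup>2"
      using zero_le_power2[of "l * q - r * \<bar>cos t\<bar>"] by linarith
    then show "l * r + q * \<bar>cos t\<bar> \<le> sqrt (l\<^sup>2 + (cos t)\<^sup>2)"
      by (rule real_le_rsqrt)
  qed
  then show ?thesis using l by (simp add: q_def field_simps)
qed

text \<open>Strictness comes from \<open>pi < 4\<close>, so it persists at \<open>r = 0\<close>,
  where \<open>1 - r\<^sup>2\<close> and its square root coincide.\<close>

lemma M_fun_gt:
  assumes "0 \<le> r" "r < 1"
  shows "1 - r\<^sup>2 < M_fun r"
proof -
  have r: "0 < 1 - r\<^sup>2" using assms by (simp add: abs_square_less_1)
  have "1 - r\<^sup>2 \<le> sqrt (1 - r\<^sup>2)"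
    using r by (intro real_le_rsqrt) (simp add: power2_eq_square mult_left_le)
  also have "\<dots> < 4 / pi * sqrt (1 - r\<^sup>2)"
    using mult_strict_right_mono[of 1 "4 / pi" "sqrt (1 - r\<^sup>2)"] r pi_less_4 by simp
  also have "\<dots> \<le> M_fun r" by (rule M_fun_ge[OF assms])
  finally show ?thesis .
qed

lemma M_fun_pos:
  assumes "0 \<le> r" "r < 1"
  shows "M_fun r > 0"
proof -
  have "0 < 1 - r\<^sup>2" using assms by (simp add: abs_square_less_1)
  then show ?thesis using M_fun_gt[OF assms] by linarith
qed

text \<open>A convex function is continuous on an open interval; the even extension makes 0 an
  interior point. Allowing negative \<open>l\<close>, the extension is still a minimum of affine
  functions of \<open>x\<close>, because \<open>cos_energy\<close> is even.\<close>

lemma continuous_on_M_fun_abs: "continuous_on {-1<..<1} (\<lambda>x. M_fun \<bar>x\<bar>)"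
proof -
  have le: "pi * M_fun \<bar>x\<bar> \<le> cos_energy l - 2 * pi * l * x" if "-1 < x" "x < 1" for x l
  proof -
    have "cos_energy \<bar>l\<bar> = cos_energy l" by (simp add: cos_energy_def)
    moreover have "pi * (l * x) \<le> pi * (\<bar>l\<bar> * \<bar>x\<bar>)"
      by (metis abs_ge_self abs_mult mult_left_mono pi_ge_zero)
    moreover have "pi * M_fun \<bar>x\<bar> \<le> cos_energy \<bar>l\<bar> - 2 * pi * \<bar>l\<bar> * \<bar>x\<bar>"
      using M_fun_variational(1)[of "\<bar>x\<bar>" "\<bar>l\<bar>"] that by simp
    ultimately show ?thesis by (simp only: mult.assoc)
  qed
  have eq: "\<exists>l. pi * M_fun \<bar>x\<bar> = cos_energy l - 2 * pi * l * x" if x: "-1 < x" "x < 1" for x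
  proof -
    have "\<bar>x\<bar> < 1" using x by linarith
    then obtain l where "pi * M_fun \<bar>x\<bar> = cos_energy l - 2 * pi * l * \<bar>x\<bar>"
      using M_fun_variational(2)[of "\<bar>x\<bar>"] by auto
    moreover have "cos_energy (-l) = cos_energy l" by (simp add: cos_energy_def)
    ultimately show ?thesis
      by (cases "x \<ge> 0") (auto intro: exI[of _ l] exI[of _ "-l"])
  qed
  have "convex_on {-1<..<1} (\<lambda>x. - (pi * M_fun \<bar>x\<bar>))"
  proof (rule convex_onI)
    fix u x y :: real
    assume u: "0 < u" "u < 1" and xy: "x \<in> {-1<..<1}" "y \<in> {-1<..<1}"
    let ?z = "(1 - u) *\<^sub>R x + u *\<^sub>R y"
    have "?z \<in> {-1<..<1}"
      using convexD_alt[OF convex_real_interval(8), of x "-1" 1 y u] u xy by auto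
    \<comment> \<open>The parameter that is optimal at the intermediate point is a competitor at
      both \<open>x\<close> and \<open>y\<close>, which yields concavity.\<close>
    then obtain l where l: "pi * M_fun \<bar>?z\<bar> = cos_energy l - 2 * pi * l * ?z"
      using eq[of ?z] by auto
    have "(1 - u) * (pi * M_fun \<bar>x\<bar>) + u * (pi * M_fun \<bar>y\<bar>)
        \<le> (1 - u) * (cos_energy l - 2 * pi * l * x) + u * (cos_energy l - 2 * pi * l * y)"
      using le[of x l] le[of y l] xy u by (intro add_mono mult_left_mono) auto
    also have "\<dots> = pi * M_fun \<bar>?z\<bar>"
      unfolding l by (simp add: algebra_simps)
    finally show "- (pi * M_fun \<bar>?z\<bar>) \<le> (1 - u) * - (pi * M_fun \<bar>x\<bar>) + u * - (pi * M_fun \<bar>y\<bar>)"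
      by simp
  qed simp
  then have "continuous_on {-1<..<1} (\<lambda>x. - (1 / pi) * - (pi * M_fun \<bar>x\<bar>))"
    by (intro continuous_on_mult continuous_on_const convex_on_continuous) auto
  then show ?thesis by simp
qed

section \<open>The Kobayashi--Royden metric of the polydisc\<close>

text \<open>Used at \<open>z = w\<close>, where the derivative is the inverse of
  \<open>1 - (norm w)\<^sup>2\<close>, and at \<open>z = 0\<close>, where it is
  \<open>1 - (norm w)\<^sup>2\<close>.\<close>

lemma has_field_derivative_Moebius:
  assumes "1 - cnj w * z \<noteq> 0"
  shows "(Moebius_function 0 w has_field_derivative (1 - cnj w * w) / (1 - cnj w * z)\<^sup>2) (at z)"
proof -
  have "((\<lambda>z. (z - w) / (1 - cnj w * z)) has_field_derivative (1 - cnj w * w) / (1 - cnj w * z)\<^sup>2) (at z)"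
    using assms by (auto intro!: derivative_eq_intros simp: power2_eq_square algebra_simps)
  then show ?thesis by (simp add: Moebius_function_simple[abs_def])
qed

lemma cnj_mult_self: "cnj w * w = of_real ((norm w)\<^sup>2)"
  by (metis complex_norm_square mult.commute)

text \<open>Composing with the Moebius map that moves \<open>f 0\<close> to 0 reduces the claim to
  the Schwarz lemma; the chain rule translates the bound back.\<close>

lemma Schwarz_Pick_deriv_0:
  assumes hol: "f holomorphic_on ball 0 1" and bd: "\<And>z. norm z < 1 \<Longrightarrow> norm (f z) < 1"
  shows "norm (deriv f 0) \<le> 1 - (norm (f 0))\<^sup>2"
proof -
  define w where "w = f 0"
  have w: "norm w < 1" using bd[of 0] by (simp add: w_def)
  have w2: "1 - (norm w)\<^sup>2 > 0" using w by (simp add: abs_square_less_1)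
  have e: "1 - cnj w * w = of_real (1 - (norm w)\<^sup>2)" by (simp add: cnj_mult_self)
  define g where "g = Moebius_function 0 w \<circ> f"
  have "g holomorphic_on ball 0 1"
    unfolding g_def
    by (rule holomorphic_on_compose_gen[OF hol Moebius_function_holomorphic[OF w]]) (auto simp: bd)
  moreover have "g 0 = 0" by (simp add: g_def w_def Moebius_function_eq_zero)
  moreover have "norm (g z) < 1" if "norm z < 1" for z
    unfolding g_def comp_apply by (intro Moebius_function_norm_lt_1 w bd that)
  ultimately have "norm (deriv g 0) \<le> 1"
    by (intro Schwarz_Lemma(2)[of g 0]) auto
  moreover have "deriv g 0 = deriv f 0 / of_real (1 - (norm w)\<^sup>2)"
  proof (rule DERIV_imp_deriv)
    have "(f has_field_derivative deriv f 0) (at 0)"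
      using hol by (auto intro!: holomorphic_derivI[of f "ball 0 1"])
    moreover have "(Moebius_function 0 w has_field_derivative 1 / of_real (1 - (norm w)\<^sup>2)) (at (f 0))"
      using has_field_derivative_Moebius[of w w] w2 e
      by (simp add: w_def[symmetric] power2_eq_square del: of_real_diff)
    ultimately have "(g has_field_derivative 1 / of_real (1 - (norm w)\<^sup>2) * deriv f 0) (at 0)"
      unfolding g_def by (intro DERIV_chain)
    then show "(g has_field_derivative deriv f 0 / of_real (1 - (norm w)\<^sup>2)) (at 0)" by simp
  qed
  ultimately show ?thesis
    using w2 by (simp add: norm_divide divide_le_eq w_def[symmetric] del: of_real_diff)
qed

text \<open>Schwarz--Pick in each coordinate bounds every admissible \<open>norm \<alpha>\<close>
  from below by the maximum \<open>m\<close>, and an explicit disc attains \<open>m\<close>, so the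
  infimum is a minimum.\<close>

lemma kobayashi_royden_polydisc:
  fixes p v :: "complex ^ 'n"
  assumes p: "p \<in> polydisc"
  shows "kobayashi_royden polydisc p v = (MAX j. norm (v $ j) / (1 - (norm (p $ j))\<^sup>2))"
proof -
  define m where "m = (MAX j. norm (v $ j) / (1 - (norm (p $ j))\<^sup>2))"
  have p1: "norm (p $ j) < 1" for j using p by (simp add: polydisc_def)
  have pos: "0 < 1 - (norm (p $ j))\<^sup>2" for j using p1[of j] by (simp add: abs_square_less_1)
  have le_m: "norm (v $ j) / (1 - (norm (p $ j))\<^sup>2) \<le> m" for j
    unfolding m_def by (rule Max_ge) auto
  have m0: "0 \<le> m"
    using le_m[of undefined] pos[of undefined] by (smt (verit) divide_nonneg_pos norm_ge_zero)
  \<comment> \<open>The factor that makes the derivative of coordinate \<open>j\<close> equal to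
    \<open>v $ j / m\<close>. If \<open>m = 0\<close>, division by zero gives
    \<open>b j = 0\<close>; the disc is then constant, which is right since
    \<open>v = 0\<close>.\<close>
  define b where "b j = v $ j / of_real (m * (1 - (norm (p $ j))\<^sup>2))" for j
  have b1: "norm (b j) \<le> 1" for j
  proof (cases "m = 0")
    case False
    then have "norm (v $ j) \<le> m * (1 - (norm (p $ j))\<^sup>2)"
      using le_m[of j] pos[of j] by (simp add: pos_divide_le_eq)
    moreover have "0 < m * (1 - (norm (p $ j))\<^sup>2)" using False m0 pos[of j] by simp
    ultimately show ?thesis
      by (simp add: b_def norm_divide divide_le_eq_1 norm_mult del: of_real_mult of_real_diff)
  qed (simp add: b_def)
  \<comment> \<open>The Moebius map with parameter \<open>- p $ j\<close> sends 0 to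
    \<open>p $ j\<close>, and its argument stays in the unit disc because
    \<open>norm (b j) \<le> 1\<close>.\<close>
  define f where "f z = (\<chi> j. Moebius_function 0 (- p $ j) (b j * z))" for z
  have bz: "norm (b j * z) < 1" if "norm z < 1" for j z
    using mult_right_mono[OF b1[of j], of "norm z"] that by (simp add: norm_mult)
  have hol: "(\<lambda>z. f z $ j) holomorphic_on ball 0 1" for j
  proof -
    have "(Moebius_function 0 (- p $ j) \<circ> (\<lambda>z. b j * z)) holomorphic_on ball 0 1"
      using p1[of j] bz
      by (intro holomorphic_on_compose_gen[OF _ Moebius_function_holomorphic] holomorphic_intros) auto
    then show ?thesis by (simp add: f_def o_def)
  qed
  have der: "deriv (\<lambda>z. f z $ j) 0 = b j * of_real (1 - (norm (p $ j))\<^sup>2)" for j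
  proof (rule DERIV_imp_deriv)
    have "(Moebius_function 0 (- p $ j) has_field_derivative of_real (1 - (norm (p $ j))\<^sup>2)) (at (b j * 0))"
      using has_field_derivative_Moebius[of "- p $ j" 0] by (simp add: cnj_mult_self)
    moreover have "((\<lambda>z. b j * z) has_field_derivative b j) (at 0)"
      by (auto intro!: derivative_eq_intros)
    ultimately have "((Moebius_function 0 (- p $ j) \<circ> (\<lambda>z. b j * z)) has_field_derivative
        of_real (1 - (norm (p $ j))\<^sup>2) * b j) (at 0)"
      by (intro DERIV_chain)
    then show "((\<lambda>z. f z $ j) has_field_derivative b j * of_real (1 - (norm (p $ j))\<^sup>2)) (at 0)"
      by (simp add: f_def o_def mult.commute)
  qed
  have "of_real m * deriv (\<lambda>z. f z $ j) 0 = v $ j" for j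
  proof (cases "m = 0")
    case True
    then show ?thesis using le_m[of j] pos[of j] by (simp add: pos_divide_le_eq)
  next
    case False
    then show ?thesis using pos[of j] by (simp add: der b_def del: of_real_diff)
  qed
  moreover have "f ` ball 0 1 \<subseteq> polydisc"
    using p1 bz by (auto simp: polydisc_def f_def intro!: Moebius_function_norm_lt_1)
  moreover have "f 0 = p"
    by (simp add: f_def vec_eq_iff Moebius_function_of_zero)
  moreover have "m = norm (of_real m :: complex)" using m0 by simp
  ultimately have mem: "m \<in> {norm \<alpha> | \<alpha> :: complex. \<exists>f :: complex \<Rightarrow> complex ^ 'n.
        (\<forall>j. (\<lambda>z. f z $ j) holomorphic_on ball 0 1) \<and> f ` ball 0 1 \<subseteq> polydisc \<and>
        f 0 = p \<and> (\<forall>j. \<alpha> * deriv (\<lambda>z. f z $ j) 0 = v $ j)}" (is "_ \<in> ?S")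
    using hol by blast
  have low: "m \<le> x" if "x \<in> ?S" for x
  proof -
    from that obtain \<alpha> f where x: "x = norm \<alpha>" and hol: "\<And>j. (\<lambda>z. f z $ j) holomorphic_on ball 0 1"
      and im: "f ` ball 0 1 \<subseteq> polydisc" and f0: "f 0 = p"
      and d: "\<And>j. \<alpha> * deriv (\<lambda>z. f z $ j) 0 = v $ j" by blast
    have "norm (v $ j) / (1 - (norm (p $ j))\<^sup>2) \<le> x" for j
    proof -
      have "norm (deriv (\<lambda>z. f z $ j) 0) \<le> 1 - (norm (p $ j))\<^sup>2"
        using Schwarz_Pick_deriv_0[OF hol[of j]] im f0 by (force simp: polydisc_def)
      then have "norm \<alpha> * norm (deriv (\<lambda>z. f z $ j) 0) \<le> norm \<alpha> * (1 - (norm (p $ j))\<^sup>2)"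
        by (intro mult_left_mono) auto
      then have "norm (v $ j) \<le> x * (1 - (norm (p $ j))\<^sup>2)"
        by (metis d norm_mult x)
      then show ?thesis using pos[of j] by (simp add: pos_divide_le_eq)
    qed
    then show ?thesis unfolding m_def by (subst Max_le_iff) auto
  qed
  show ?thesis
    unfolding kobayashi_royden_def m_def[symmetric] by (rule cInf_eq_minimum[OF mem low])
qed

section \<open>Strict comparison of the two metrics\<close>

text \<open>Coordinates with \<open>v $ j \<noteq> 0\<close> are strictly smaller by
  \<open>M_fun_gt\<close>; the vanishing ones lie below the maximum because it is positive for
  \<open>v \<noteq> 0\<close>. A finite maximum preserves strictness.\<close>

lemma H_metric_less_kobayashi:
  fixes p v :: "complex ^ 'n"
  assumes p: "p \<in> polydisc" and v: "v \<noteq> 0"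
  shows "H_metric p v < (MAX j. 2 * norm (v $ j) / (1 - (norm (p $ j))\<^sup>2))"
proof -
  have p1: "norm (p $ j) < 1" for j using p by (simp add: polydisc_def)
  have pos: "0 < 1 - (norm (p $ j))\<^sup>2" for j using p1[of j] by (simp add: abs_square_less_1)
  let ?m = "MAX j. 2 * norm (v $ j) / (1 - (norm (p $ j))\<^sup>2)"
  have le_m: "2 * norm (v $ j) / (1 - (norm (p $ j))\<^sup>2) \<le> ?m" for j
    by (rule Max_ge) auto
  obtain i where i: "v $ i \<noteq> 0" using v by (auto simp: vec_eq_iff)
  have "0 < 2 * norm (v $ i) / (1 - (norm (p $ i))\<^sup>2)" using i pos[of i] by simp
  with le_m[of i] have m: "0 < ?m" by linarith
  have "2 * norm (v $ j) / M_fun (norm (p $ j)) < ?m" for j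
  proof (cases "v $ j = 0")
    case False
    have M: "1 - (norm (p $ j))\<^sup>2 < M_fun (norm (p $ j))"
      by (rule M_fun_gt) (auto simp: p1)
    then have "2 * norm (v $ j) / M_fun (norm (p $ j)) < 2 * norm (v $ j) / (1 - (norm (p $ j))\<^sup>2)"
      using False pos[of j] by (intro divide_strict_left_mono mult_pos_pos) auto
    then show ?thesis using le_m[of j] by linarith
  qed (use m in simp)
  then show ?thesis unfolding H_metric_def by (subst Max_less_iff) auto
qed

lemma two_kobayashi_royden_polydisc:
  fixes p v :: "complex ^ 'n"
  assumes p: "p \<in> polydisc"
  shows "2 * kobayashi_royden polydisc p v = (MAX j. 2 * norm (v $ j) / (1 - (norm (p $ j))\<^sup>2))"
proof -
  have "2 * Max (range (\<lambda>j. norm (v $ j) / (1 - (norm (p $ j))\<^sup>2)))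
      = Max ((\<lambda>x. 2 * x) ` range (\<lambda>j. norm (v $ j) / (1 - (norm (p $ j))\<^sup>2)))"
    by (rule mono_Max_commute) (auto simp: mono_def)
  then show ?thesis by (simp add: kobayashi_royden_polydisc[OF p] image_image)
qed

section \<open>Lengths of piecewise continuously differentiable paths\<close>

lemma H_metric_le_iff: "H_metric p v \<le> c \<longleftrightarrow> (\<forall>j. 2 * norm (v $ j) / M_fun (norm (p $ j)) \<le> c)"
  unfolding H_metric_def by (subst Max_le_iff) auto

lemma H_metric_scaleR: "H_metric p (c *\<^sub>R v) = \<bar>c\<bar> * H_metric p v"
proof -
  have "\<bar>c\<bar> * Max (range (\<lambda>j. 2 * norm (v $ j) / M_fun (norm (p $ j))))
      = Max ((\<lambda>x. \<bar>c\<bar> * x) ` range (\<lambda>j. 2 * norm (v $ j) / M_fun (norm (p $ j))))"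
    by (rule mono_Max_commute) (auto simp: mono_def mult_left_mono)
  then show ?thesis by (simp add: H_metric_def image_image mult.left_commute)
qed

text \<open>The upper bound \<open>4 / pi\<close> of \<open>M_fun\<close> lets the metric dominate
  each coordinate. This later separates points and identifies limits.\<close>

lemma H_metric_ge:
  assumes "p \<in> polydisc"
  shows "pi / 2 * norm (v $ j) \<le> H_metric p v"
proof -
  let ?r = "norm (p $ j)"
  have r: "?r < 1" using assms by (simp add: polydisc_def)
  have M: "0 < M_fun ?r" "M_fun ?r \<le> 4 / pi"
    using r by (auto intro: M_fun_pos M_fun_le)
  have "pi / 2 * norm (v $ j) = 2 * norm (v $ j) / (4 / pi)" by simp
  also have "\<dots> \<le> 2 * norm (v $ j) / M_fun ?r"
    using M by (intro divide_left_mono mult_pos_pos) auto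
  also have "\<dots> \<le> H_metric p v"
    using H_metric_le_iff[of p v "H_metric p v"] by simp
  finally show ?thesis .
qed

lemma continuous_on_Max_image:
  fixes f :: "'i \<Rightarrow> 'a::topological_space \<Rightarrow> real"
  assumes "finite I" "I \<noteq> {}" "\<And>i. i \<in> I \<Longrightarrow> continuous_on A (f i)"
  shows "continuous_on A (\<lambda>x. Max ((\<lambda>i. f i x) ` I))"
  using assms by (induction I rule: finite_ne_induct) (auto intro!: continuous_on_max)

lemma continuous_on_H_metric:
  fixes g h :: "real \<Rightarrow> complex ^ 'n"
  assumes g: "continuous_on A g" "g ` A \<subseteq> polydisc" and h: "continuous_on A h"
  shows "continuous_on A (\<lambda>s. H_metric (g s) (h s))"
  unfolding H_metric_def
proof (rule continuous_on_Max_image)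
  fix j :: 'n
  have r: "norm (g s $ j) < 1" if "s \<in> A" for s
    using g(2) that by (auto simp: polydisc_def)
  have "continuous_on A (\<lambda>s. norm (g s $ j))"
    by (intro continuous_intros g)
  \<comment> \<open>The redundant absolute value matches the even extension, whose domain is open at
    0.\<close>
  then have "continuous_on A (\<lambda>s. M_fun \<bar>norm (g s $ j)\<bar>)"
  proof (rule continuous_on_compose2[OF continuous_on_M_fun_abs])
    have "-1 < norm (g s $ j)" for s
      using norm_ge_zero[of "g s $ j"] by linarith
    with r show "(\<lambda>s. norm (g s $ j)) ` A \<subseteq> {-1<..<1}" by auto
  qed
  then have "continuous_on A (\<lambda>s. M_fun (norm (g s $ j)))" by simp
  moreover have "M_fun (norm (g s $ j)) \<noteq> 0" if "s \<in> A" for s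
    using M_fun_pos[of "norm (g s $ j)"] r[OF that] by simp
  ultimately show "continuous_on A (\<lambda>s. 2 * norm (h s $ j) / M_fun (norm (g s $ j)))"
    by (intro continuous_intros h) auto
qed auto

section \<open>Piecewise continuously differentiable paths as chains\<close>

text \<open>
  An inductive form of \<open>piecewise_C1_path\<close> on an arbitrary interval: it makes concatenation
  and affine reparametrization free of partition indices.
\<close>

inductive C1_chain :: "(real \<Rightarrow> 'a :: real_normed_vector) \<Rightarrow> real \<Rightarrow> real \<Rightarrow> bool" for \<gamma> where
  refl: "C1_chain \<gamma> a a"
| step: "C1_chain \<gamma> a b \<Longrightarrow> b < c \<Longrightarrow> continuous_on {b..c} \<gamma>' \<Longrightarrow>
    (\<And>s. s \<in> {b..c} \<Longrightarrow> (\<gamma> has_vector_derivative \<gamma>' s) (at s within {b..c})) \<Longrightarrow> C1_chain \<gamma> a c"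

lemma C1_chain_le: "C1_chain \<gamma> a b \<Longrightarrow> a \<le> b"
  by (induction rule: C1_chain.induct) auto

lemma C1_chain_trans:
  assumes "C1_chain \<gamma> b c" "C1_chain \<gamma> a b"
  shows "C1_chain \<gamma> a c"
  using assms by (induction rule: C1_chain.induct) (blast intro: C1_chain.step)+

lemma C1_chain_single:
  assumes "a < b" "continuous_on {a..b} \<gamma>'"
    "\<And>s. s \<in> {a..b} \<Longrightarrow> (\<gamma> has_vector_derivative \<gamma>' s) (at s within {a..b})"
  shows "C1_chain \<gamma> a b"
  using C1_chain.step[OF C1_chain.refl assms] .

lemma C1_chain_cong:
  assumes "C1_chain \<gamma> a b" "\<And>s. s \<in> {a..b} \<Longrightarrow> \<gamma> s = \<delta> s"
  shows "C1_chain \<delta> a b"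
  using assms
proof (induction rule: C1_chain.induct)
  case (step a b c \<gamma>')
  have "a \<le> b" using step.hyps by (simp add: C1_chain_le)
  with step show ?case
    by (intro C1_chain.step[of \<delta> a b c \<gamma>'])
       (auto intro!: has_vector_derivative_transform[of _ _ \<delta> \<gamma>])
qed (rule C1_chain.refl)

text \<open>A partition gives a chain by induction along its points. Conversely, each step appends
  its right end point to the partition, starting from the empty one with
  \<open>k = 0\<close>.\<close>

lemma piecewise_C1_path_iff_C1_chain: "piecewise_C1_path \<gamma> \<longleftrightarrow> C1_chain \<gamma> 0 1"
proof
  assume "piecewise_C1_path \<gamma>"
  then obtain k t where t: "t 0 = 0" "t k = 1" and *: "\<forall>i<k. t i < t (Suc i) \<and>
           (\<exists>\<gamma>'. continuous_on {t i..t (Suc i)} \<gamma>' \<and>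
              (\<forall>s\<in>{t i..t (Suc i)}.
                 (\<gamma> has_vector_derivative \<gamma>' s) (at s within {t i..t (Suc i)})))"
    unfolding piecewise_C1_path_def by blast
  have "i \<le> k \<Longrightarrow> C1_chain \<gamma> (t 0) (t i)" for i
  proof (induction i)
    case (Suc i)
    then show ?case using *[rule_format, of i] by (auto intro: C1_chain.step)
  qed (rule C1_chain.refl)
  from this[of k] show "C1_chain \<gamma> 0 1" by (simp add: t)
next
  have "\<exists>(k :: nat) t. t 0 = a \<and> t k = b \<and> (\<forall>i<k. t i < t (Suc i) \<and>
           (\<exists>\<gamma>'. continuous_on {t i..t (Suc i)} \<gamma>' \<and>
              (\<forall>s\<in>{t i..t (Suc i)}.
                 (\<gamma> has_vector_derivative \<gamma>' s) (at s within {t i..t (Suc i)}))))"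
    if "C1_chain \<gamma> a b" for a b
    using that
  proof (induction rule: C1_chain.induct)
    case (refl a)
    show ?case by (intro exI[of _ 0] exI[of _ "\<lambda>_. a"]) auto
  next
    case (step a b c \<gamma>')
    then obtain k t where t: "t 0 = a" "t k = b" and *: "\<forall>i<k. t i < t (Suc i) \<and>
           (\<exists>\<gamma>'. continuous_on {t i..t (Suc i)} \<gamma>' \<and>
              (\<forall>s\<in>{t i..t (Suc i)}.
                 (\<gamma> has_vector_derivative \<gamma>' s) (at s within {t i..t (Suc i)})))" by blast
    show ?case
      using t * step(2-4)
      by (intro exI[of _ "Suc k"] exI[of _ "t(Suc k := c)"]) (auto simp: less_Suc_eq)
  qed
  from this[of 0 1] show "C1_chain \<gamma> 0 1 \<Longrightarrow> piecewise_C1_path \<gamma>"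
    unfolding piecewise_C1_path_def by blast
qed

text \<open>The chain rule on a single piece, for either sign of \<open>m\<close>, so that it serves
  both orientations.\<close>

lemma C1_chain_single_affine:
  assumes "a < b" "continuous_on {a..b} \<gamma>'" "m \<noteq> 0"
    and der: "\<And>s. s \<in> {a..b} \<Longrightarrow> (\<gamma> has_vector_derivative \<gamma>' s) (at s within {a..b})"
    and uw: "u < w" "(\<lambda>s. m * s + c) ` {u..w} \<subseteq> {a..b}"
  shows "C1_chain (\<lambda>s. \<gamma> (m * s + c)) u w"
proof (rule C1_chain_single[OF uw(1)])
  have "continuous_on {u..w} (\<lambda>s. \<gamma>' (m * s + c))"
    by (rule continuous_on_compose2[OF assms(2) _ uw(2)]) (intro continuous_intros)
  then show "continuous_on {u..w} (\<lambda>s. m *\<^sub>R \<gamma>' (m * s + c))"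
    by (intro continuous_intros)
  fix s assume s: "s \<in> {u..w}"
  have "((\<lambda>s. m * s + c) has_vector_derivative m) (at s within {u..w})"
    by (auto intro!: derivative_eq_intros simp: has_real_derivative_iff_has_vector_derivative[symmetric])
  moreover have "(\<gamma> has_vector_derivative \<gamma>' (m * s + c)) (at (m * s + c) within (\<lambda>s. m * s + c) ` {u..w})"
    using s uw(2) by (intro has_vector_derivative_within_subset[OF der]) blast+
  ultimately show "((\<lambda>s. \<gamma> (m * s + c)) has_vector_derivative m *\<^sub>R \<gamma>' (m * s + c)) (at s within {u..w})"
    using vector_diff_chain_within by (fastforce simp: o_def)
qed

lemma C1_chain_affine:
  assumes "C1_chain \<gamma> a b" "m > 0"
  shows "C1_chain (\<lambda>s. \<gamma> (m * s + c)) ((a - c) / m) ((b - c) / m)"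
  using assms
proof (induction rule: C1_chain.induct)
  case (step a b d \<gamma>')
  have "C1_chain (\<lambda>s. \<gamma> (m * s + c)) ((b - c) / m) ((d - c) / m)"
    using step(2,3,4) \<open>m > 0\<close>
    by (intro C1_chain_single_affine[of b d \<gamma>']) (auto simp: divide_strict_right_mono field_simps)
  then show ?case using step by (blast intro: C1_chain_trans)
qed (rule C1_chain.refl)

text \<open>Reversal puts the image of the last piece first, so the concatenation runs in the
  opposite order.\<close>

lemma C1_chain_affine_neg:
  assumes "C1_chain \<gamma> a b" "m < 0"
  shows "C1_chain (\<lambda>s. \<gamma> (m * s + c)) ((b - c) / m) ((a - c) / m)"
  using assms
proof (induction rule: C1_chain.induct)
  case (step a b d \<gamma>')
  have "C1_chain (\<lambda>s. \<gamma> (m * s + c)) ((d - c) / m) ((b - c) / m)"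
    using step(2,3,4) \<open>m < 0\<close>
    by (intro C1_chain_single_affine[of b d \<gamma>']) (auto simp: field_simps)
  then show ?case using step by (blast intro: C1_chain_trans)
qed (rule C1_chain.refl)

lemma C1_chain_continuous_on:
  assumes "C1_chain \<gamma> a b"
  shows "continuous_on {a..b} \<gamma>"
  using assms
proof (induction rule: C1_chain.induct)
  case (step a b c \<gamma>')
  have "{a..b} \<union> {b..c} = {a..c}" using step.hyps C1_chain_le by force
  moreover have "continuous_on {b..c} \<gamma>"
    using step.hyps by (intro continuous_on_vector_derivative) auto
  ultimately show ?case using step.IH continuous_on_closed_Un[of "{a..b}" "{b..c}" \<gamma>] by simp
qed simp

text \<open>In the interior of a piece the derivative within the interval is a two-sided derivative,
  so only break points are exceptional.\<close>

lemma C1_chain_differentiable: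
  assumes "C1_chain \<gamma> a b"
  shows "\<exists>S. finite S \<and> (\<forall>s\<in>{a..b} - S. \<gamma> differentiable (at s))"
  using assms
proof (induction rule: C1_chain.induct)
  case (refl a)
  show ?case by (intro exI[of _ "{a}"]) auto
next
  case (step a b c \<gamma>')
  then obtain S where S: "finite S" "\<forall>s\<in>{a..b} - S. \<gamma> differentiable (at s)" by blast
  have "\<gamma> differentiable (at s)" if "s \<in> {b<..<c}" for s
    using step(4)[of s] that by (auto simp: at_within_Icc_at intro: differentiableI_vector)
  then have "\<gamma> differentiable (at s)" if "s \<in> {a..c} - insert b (insert c S)" for s
    using that S(2) by (cases "s < b") auto
  with S(1) show ?case by (intro exI[of _ "insert b (insert c S)"]) auto
qed

section \<open>Integrability of the speed and invariance of length\<close>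

abbreviation H_speed :: "(real \<Rightarrow> complex ^ 'n) \<Rightarrow> real \<Rightarrow> real" where
  "H_speed \<gamma> s \<equiv> H_metric (\<gamma> s) (vector_derivative \<gamma> (at s))"

text \<open>On each piece the speed agrees, off the end points, with a continuous function. Hence
  \<open>H_length\<close> is a genuine integral and not a default value.\<close>

lemma C1_chain_H_speed_integrable:
  assumes "C1_chain \<gamma> a b" "\<gamma> ` {a..b} \<subseteq> polydisc"
  shows "H_speed \<gamma> integrable_on {a..b}"
  using assms
proof (induction rule: C1_chain.induct)
  case (refl a)
  show ?case using integrable_on_refl[of _ a] by simp
next
  case (step a b c \<gamma>')
  have le: "a \<le> b" using step.hyps by (simp add: C1_chain_le)
  have sub: "\<gamma> ` {a..b} \<subseteq> polydisc" "\<gamma> ` {b..c} \<subseteq> polydisc"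
    using step.prems step.hyps(2) le by (auto simp: image_subset_iff)
  have "continuous_on {b..c} \<gamma>"
    using step.hyps(4) by (rule continuous_on_vector_derivative)
  then have "continuous_on {b..c} (\<lambda>s. H_metric (\<gamma> s) (\<gamma>' s))"
    using sub(2) step.hyps(3) by (rule continuous_on_H_metric)
  then have int: "(\<lambda>s. H_metric (\<gamma> s) (\<gamma>' s)) integrable_on {b..c}"
    by (rule integrable_continuous_real)
  have "vector_derivative \<gamma> (at s) = \<gamma>' s" if "s \<in> {b..c} - {b, c}" for s
    using step(4)[of s] that by (intro vector_derivative_at) (auto simp: at_within_Icc_at)
  then have "H_speed \<gamma> integrable_on {b..c}"
    by (intro integrable_spike_finite[OF _ _ int, of "{b, c}"]) auto
  with le less_imp_le[OF step.hyps(2)] step.IH[OF sub(1)] show ?case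
    by (rule Henstock_Kurzweil_Integration.integrable_combine)
qed

text \<open>Chain rule and absolute homogeneity. Differentiability is assumed because
  \<open>vector_derivative\<close> is arbitrary where no derivative exists.\<close>

lemma H_speed_affine:
  assumes "\<gamma> differentiable (at (m * s + c))"
  shows "H_speed (\<lambda>s. \<gamma> (m * s + c)) s = \<bar>m\<bar> * H_speed \<gamma> (m * s + c)"
proof -
  have "((\<lambda>s. m * s + c) has_vector_derivative m) (at s)"
    by (auto intro!: derivative_eq_intros simp: has_real_derivative_iff_has_vector_derivative[symmetric])
  moreover have "(\<gamma> has_vector_derivative vector_derivative \<gamma> (at (m * s + c))) (at (m * s + c))"
    using assms by (simp add: vector_derivative_works)
  ultimately have "((\<lambda>s. \<gamma> (m * s + c)) has_vector_derivative
      m *\<^sub>R vector_derivative \<gamma> (at (m * s + c))) (at s)"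
    using vector_diff_chain_at by (fastforce simp: o_def)
  then show ?thesis by (simp add: vector_derivative_at H_metric_scaleR)
qed

text \<open>The factor \<open>1 / \<bar>m\<bar>\<close> of the substitution cancels the factor
  \<open>\<bar>m\<bar>\<close> of the speed; the finitely many points mapped to exceptional ones do
  not affect the integral.\<close>

lemma has_integral_H_speed_affine:
  assumes "C1_chain \<gamma> a b" "(H_speed \<gamma> has_integral L) {a..b}" "m \<noteq> 0"
  shows "(H_speed (\<lambda>s. \<gamma> (m * s + c)) has_integral L) ((\<lambda>x. (x - c) / m) ` {a..b})"
proof -
  obtain S where S: "finite S" "\<And>s. s \<in> {a..b} - S \<Longrightarrow> \<gamma> differentiable (at s)"
    using C1_chain_differentiable[OF assms(1)] by blast
  have "((\<lambda>s. H_speed \<gamma> (m *\<^sub>R s + c)) has_integral (1 / \<bar>m\<bar>) *\<^sub>R L)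
      ((\<lambda>x. (1 / m) *\<^sub>R x + - ((1 / m) *\<^sub>R c)) ` {a..b})"
    using has_integral_affinity[of "H_speed \<gamma>" L a b m c] assms(2,3) by simp
  moreover have "(\<lambda>x. (1 / m) *\<^sub>R x + - ((1 / m) *\<^sub>R c)) = (\<lambda>x. (x - c) / m)"
    by (simp add: fun_eq_iff diff_divide_distrib)
  ultimately have "((\<lambda>s. H_speed \<gamma> (m * s + c)) has_integral L / \<bar>m\<bar>) ((\<lambda>x. (x - c) / m) ` {a..b})"
    by (simp only: real_scaleR_def) simp
  from has_integral_mult_right[OF this, of "\<bar>m\<bar>"]
  have *: "((\<lambda>s. \<bar>m\<bar> * H_speed \<gamma> (m * s + c)) has_integral L) ((\<lambda>x. (x - c) / m) ` {a..b})"
    using assms(3) by simp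
  show ?thesis
  proof (rule has_integral_spike_finite[OF _ _ *])
    show "finite ((\<lambda>x. (x - c) / m) ` S)" using S(1) by simp
    fix s assume s: "s \<in> (\<lambda>x. (x - c) / m) ` {a..b} - (\<lambda>x. (x - c) / m) ` S"
    then have "m * s + c \<in> {a..b} - S"
      using assms(3) by (auto simp: image_iff)
    then show "H_speed (\<lambda>s. \<gamma> (m * s + c)) s = \<bar>m\<bar> * H_speed \<gamma> (m * s + c)"
      by (intro H_speed_affine S)
  qed
qed

text \<open>The curves over which \<open>d_H\<close> takes its infimum, with their smoothness
  expressed by \<open>C1_chain\<close>.\<close>

definition joins_in_polydisc :: "complex ^ 'n \<Rightarrow> complex ^ 'n \<Rightarrow> (real \<Rightarrow> complex ^ 'n) \<Rightarrow> bool" where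
  "joins_in_polydisc x y \<gamma> \<longleftrightarrow> C1_chain \<gamma> 0 1 \<and> \<gamma> ` {0..1} \<subseteq> polydisc \<and> \<gamma> 0 = x \<and> \<gamma> 1 = y"

lemma joins_in_polydisc_H_length:
  "joins_in_polydisc x y \<gamma> \<Longrightarrow> (H_speed \<gamma> has_integral H_length \<gamma>) {0..1}"
  unfolding joins_in_polydisc_def H_length_def
  by (intro integrable_integral C1_chain_H_speed_integrable) auto

text \<open>The fundamental theorem of calculus for coordinate \<open>j\<close>, which tolerates
  finitely many exceptional points, combined with the pointwise bound
  \<open>H_metric_ge\<close>.\<close>

lemma H_length_ge:
  assumes "joins_in_polydisc x y \<gamma>"
  shows "pi / 2 * norm (y $ j - x $ j) \<le> H_length \<gamma>"
proof -
  have ch: "C1_chain \<gamma> 0 1" and im: "\<gamma> ` {0..1} \<subseteq> polydisc" and xy: "\<gamma> 0 = x" "\<gamma> 1 = y"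
    using assms by (auto simp: joins_in_polydisc_def)
  obtain S where S: "finite S" "\<And>s. s \<in> {0..1} - S \<Longrightarrow> \<gamma> differentiable (at s)"
    using C1_chain_differentiable[OF ch] by blast
  have I: "((\<lambda>s. vector_derivative \<gamma> (at s) $ j) has_integral \<gamma> 1 $ j - \<gamma> 0 $ j) {0..1}"
  proof (rule fundamental_theorem_of_calculus_interior_strong[OF S(1)])
    show "continuous_on {0..1} (\<lambda>s. \<gamma> s $ j)"
      by (intro continuous_intros C1_chain_continuous_on ch)
    fix s :: real assume "s \<in> {0<..<1} - S"
    then have "(\<gamma> has_vector_derivative vector_derivative \<gamma> (at s)) (at s)"
      using S(2)[of s] by (simp add: vector_derivative_works)
    then show "((\<lambda>s. \<gamma> s $ j) has_vector_derivative vector_derivative \<gamma> (at s) $ j) (at s)"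
      using bounded_linear.has_vector_derivative[OF bounded_linear_vec_nth] by blast
  qed simp
  have "norm (integral {0..1} (\<lambda>s. vector_derivative \<gamma> (at s) $ j)) \<le> integral {0..1} (\<lambda>s. 2 / pi * H_speed \<gamma> s)"
  proof (rule integral_norm_bound_integral)
    show "(\<lambda>s. vector_derivative \<gamma> (at s) $ j) integrable_on {0..1}" using I by blast
    show "(\<lambda>s. 2 / pi * H_speed \<gamma> s) integrable_on {0..1}"
      by (intro integrable_on_mult_right C1_chain_H_speed_integrable ch im)
    fix s :: real assume "s \<in> {0..1}"
    then have "\<gamma> s \<in> polydisc" using im by auto
    from H_metric_ge[OF this, of "vector_derivative \<gamma> (at s)" j]
    show "norm (vector_derivative \<gamma> (at s) $ j) \<le> 2 / pi * H_speed \<gamma> s"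
      by (simp add: field_simps)
  qed
  also have "\<dots> = 2 / pi * H_length \<gamma>"
    by (simp add: H_length_def)
  finally have "norm (y $ j - x $ j) \<le> 2 / pi * H_length \<gamma>"
    using I xy by (simp add: integral_unique)
  then show ?thesis by (simp add: field_simps)
qed

text \<open>The reversed parameter is written \<open>- 1 * s + 1\<close> to fit the affine form
  \<open>m * s + c\<close>.\<close>

lemma joins_in_polydisc_reverse:
  assumes "joins_in_polydisc x y \<gamma>"
  shows "joins_in_polydisc y x (\<lambda>s. \<gamma> (- 1 * s + 1))"
    and "H_length (\<lambda>s. \<gamma> (- 1 * s + 1)) = H_length \<gamma>"
proof -
  have im: "(\<lambda>x. (x - 1) / - 1) ` {0..1} = {0..1::real}"
    by (auto simp: image_iff intro!: bexI[of _ "1 - _"])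
  show "joins_in_polydisc y x (\<lambda>s. \<gamma> (- 1 * s + 1))"
    using assms C1_chain_affine_neg[of \<gamma> 0 1 "-1" 1] by (auto simp: joins_in_polydisc_def)
  have "(H_speed (\<lambda>s. \<gamma> (- 1 * s + 1)) has_integral H_length \<gamma>) ((\<lambda>x. (x - 1) / - 1) ` {0..1})"
    using assms by (intro has_integral_H_speed_affine joins_in_polydisc_H_length)
      (auto simp: joins_in_polydisc_def)
  then show "H_length (\<lambda>s. \<gamma> (- 1 * s + 1)) = H_length \<gamma>"
    unfolding im H_length_def by (rule integral_unique)
qed

text \<open>The derivative depends on nearby values, so agreement on an open set is
  required.\<close>

lemma H_speed_cong:
  assumes "open A" "s \<in> A" "\<And>u. u \<in> A \<Longrightarrow> \<gamma> u = \<delta> u"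
  shows "H_speed \<gamma> s = H_speed \<delta> s"
proof -
  have "\<forall>\<^sub>F u in nhds s. \<gamma> u = \<delta> u"
    using assms by (auto simp: eventually_nhds)
  then have "vector_derivative \<gamma> (at s) = vector_derivative \<delta> (at s)"
    by (intro vector_derivative_cong_eq) (auto elim: eventually_mono)
  then show ?thesis using assms by simp
qed

text \<open>Each half of the join is an affine copy of one path at double speed, hence of the same
  length. The joint \<open>1 / 2\<close> is left out when speeds are compared, as the one-sided
  derivatives may differ there.\<close>

lemma joins_in_polydisc_join:
  assumes g: "joins_in_polydisc x y g" and h: "joins_in_polydisc y z h"
  shows "joins_in_polydisc x z (g +++ h)" and "H_length (g +++ h) = H_length g + H_length h"
proof -
  define g' where "g' s = g (2 * s + 0)" for s
  define h' where "h' s = h (2 * s + - 1)" for s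
  have eq1: "(g +++ h) s = g' s" if "s \<le> 1 / 2" for s
    using that by (simp add: joinpaths_def g'_def)
  have eq2: "(g +++ h) s = h' s" if "1 / 2 \<le> s" for s
  proof (cases "s = 1 / 2")
    case True
    then have s: "2 * s = 1" by simp
    show ?thesis using g h by (simp add: joinpaths_def h'_def joins_in_polydisc_def s)
  qed (use that in \<open>simp add: joinpaths_def h'_def\<close>)
  have c1: "C1_chain g' 0 (1 / 2)"
    using C1_chain_affine[of g 0 1 2 0] g by (simp add: g'_def[abs_def] joins_in_polydisc_def)
  have c2: "C1_chain h' (1 / 2) 1"
    using C1_chain_affine[of h 0 1 2 "-1"] h by (simp add: h'_def[abs_def] joins_in_polydisc_def)
  have ch: "C1_chain (g +++ h) 0 1"
    using C1_chain_cong[OF c1, of "g +++ h"] C1_chain_cong[OF c2, of "g +++ h"] eq1 eq2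
    by (intro C1_chain_trans[of _ "1 / 2" 1 0]) auto
  have "(g +++ h) s \<in> polydisc" if "s \<in> {0..1}" for s
    using that g h eq1[of s] eq2[of s]
    by (cases "s \<le> 1 / 2") (auto simp: g'_def h'_def joins_in_polydisc_def image_subset_iff)
  moreover have "(g +++ h) 0 = x" "(g +++ h) 1 = z"
    using g h by (auto simp: joinpaths_def joins_in_polydisc_def)
  ultimately show "joins_in_polydisc x z (g +++ h)"
    using ch by (auto simp: joins_in_polydisc_def)
  have im1: "(\<lambda>x. (x - 0) / 2) ` {0..1} = {0..1 / 2 :: real}"
    by (auto simp: image_iff intro!: bexI[of _ "2 * _"])
  have im2: "(\<lambda>x. (x - - 1) / 2) ` {0..1} = {1 / 2..1 :: real}"
    by (auto simp: image_iff intro!: bexI[of _ "2 * _ - 1"])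
  have "(H_speed g' has_integral H_length g) {0..1 / 2}"
    unfolding im1[symmetric] g'_def[abs_def] using g
    by (intro has_integral_H_speed_affine joins_in_polydisc_H_length) (auto simp: joins_in_polydisc_def)
  then have i1: "(H_speed (g +++ h) has_integral H_length g) {0..1 / 2}"
    by (rule has_integral_spike_finite[of "{1 / 2}", rotated 2])
       (auto intro!: H_speed_cong[of "{..<1 / 2}"] eq1)
  have "(H_speed h' has_integral H_length h) {1 / 2..1}"
    unfolding im2[symmetric] h'_def[abs_def] using h
    by (intro has_integral_H_speed_affine joins_in_polydisc_H_length) (auto simp: joins_in_polydisc_def)
  then have i2: "(H_speed (g +++ h) has_integral H_length h) {1 / 2..1}"
    by (rule has_integral_spike_finite[of "{1 / 2}", rotated 2])
       (auto intro!: H_speed_cong[of "{1 / 2<..}"] eq2)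
  have "(H_speed (g +++ h) has_integral H_length g + H_length h) {0..1}"
    using has_integral_combine[OF _ _ i1 i2] by simp
  then show "H_length (g +++ h) = H_length g + H_length h"
    unfolding H_length_def[of "g +++ h"] by (rule integral_unique)
qed

lemma convex_polydisc: "convex (polydisc :: (complex ^ 'n) set)"
proof (rule convexI)
  fix x y :: "complex ^ 'n" and u v :: real
  assume "x \<in> polydisc" "y \<in> polydisc" and uv: "0 \<le> u" "0 \<le> v" "u + v = 1"
  then have "x $ j \<in> ball 0 1" "y $ j \<in> ball 0 1" for j by (auto simp: polydisc_def)
  then have "u *\<^sub>R x $ j + v *\<^sub>R y $ j \<in> ball 0 1" for j
    using convexD[OF convex_ball _ _ uv] by blast
  then show "u *\<^sub>R x + v *\<^sub>R y \<in> polydisc" by (simp add: polydisc_def)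
qed

lemma joins_in_polydisc_linepath:
  assumes "x \<in> polydisc" "y \<in> polydisc"
  shows "joins_in_polydisc x y (linepath x y)"
proof -
  have "linepath x y ` {0..1} \<subseteq> polydisc"
    using closed_segment_subset[OF assms convex_polydisc] linepath_image_01 by blast
  moreover have "C1_chain (linepath x y) 0 1"
    by (rule C1_chain_single[of _ _ "\<lambda>_. y - x"]) (auto intro: has_vector_derivative_linepath_within)
  ultimately show ?thesis by (simp add: joins_in_polydisc_def linepath_def)
qed

section \<open>The path distance is a metric\<close>

lemma d_H_eq:
  assumes "x \<in> polydisc" "y \<in> polydisc"
  shows "d_H x y = Inf {H_length \<gamma> | \<gamma>. joins_in_polydisc x y \<gamma>}"
proof -
  have "(piecewise_C1_path \<gamma> \<and> path_image \<gamma> \<subseteq> polydisc \<and> pathstart \<gamma> = x \<and> pathfinish \<gamma> = y)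
      \<longleftrightarrow> joins_in_polydisc x y \<gamma>" for \<gamma>
    by (simp add: piecewise_C1_path_iff_C1_chain joins_in_polydisc_def path_image_def
        pathstart_def pathfinish_def)
  then show ?thesis using assms by (simp add: d_H_def)
qed

lemma H_length_nonneg: "joins_in_polydisc x y \<gamma> \<Longrightarrow> 0 \<le> H_length \<gamma>"
  using H_length_ge[of x y \<gamma> undefined] by (rule order_trans[rotated]) auto

lemma joins_in_polydisc_ends: "joins_in_polydisc x y \<gamma> \<Longrightarrow> x \<in> polydisc \<and> y \<in> polydisc"
  by (auto simp: joins_in_polydisc_def)

lemma d_H_le:
  assumes "joins_in_polydisc x y \<gamma>"
  shows "d_H x y \<le> H_length \<gamma>"
proof -
  have "bdd_below {H_length \<gamma> | \<gamma>. joins_in_polydisc x y \<gamma>}"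
    by (rule bdd_belowI[of _ 0]) (auto intro: H_length_nonneg)
  then show ?thesis
    using assms joins_in_polydisc_ends[OF assms] by (auto simp: d_H_eq intro!: cInf_lower)
qed

text \<open>The segment, which lies in the polydisc by convexity, makes the set of lengths nonempty,
  as a lower bound for its infimum requires.\<close>

lemma d_H_greatest:
  assumes "x \<in> polydisc" "y \<in> polydisc" "\<And>\<gamma>. joins_in_polydisc x y \<gamma> \<Longrightarrow> c \<le> H_length \<gamma>"
  shows "c \<le> d_H x y"
  unfolding d_H_eq[OF assms(1,2)] using joins_in_polydisc_linepath[OF assms(1,2)] assms(3)
  by (intro cInf_greatest) auto

lemma d_H_ge:
  assumes "x \<in> polydisc" "y \<in> polydisc"
  shows "pi / 2 * norm (y $ j - x $ j) \<le> d_H x y"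
  using assms by (intro d_H_greatest H_length_ge)

lemma d_H_le_swap:
  assumes "x \<in> polydisc" "y \<in> polydisc"
  shows "d_H x y \<le> d_H y x"
proof (rule d_H_greatest[OF assms(2,1)])
  fix \<gamma> assume "joins_in_polydisc y x \<gamma>"
  from joins_in_polydisc_reverse[OF this] show "d_H x y \<le> H_length \<gamma>"
    by (metis d_H_le)
qed

text \<open>Lengths add under joining. With the first path fixed the infimum is taken over the
  second, and then over the first.\<close>

lemma d_H_triangle:
  assumes "x \<in> polydisc" "y \<in> polydisc" "z \<in> polydisc"
  shows "d_H x z \<le> d_H x y + d_H y z"
proof -
  have "d_H x z - H_length g \<le> d_H y z" if g: "joins_in_polydisc x y g" for g
  proof (rule d_H_greatest[OF assms(2,3)])
    fix h assume h: "joins_in_polydisc y z h"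
    show "d_H x z - H_length g \<le> H_length h"
      using d_H_le[OF joins_in_polydisc_join(1)[OF g h]] joins_in_polydisc_join(2)[OF g h] by simp
  qed
  then have "d_H x z - d_H y z \<le> d_H x y"
    by (intro d_H_greatest assms) (simp add: algebra_simps)
  then show ?thesis by simp
qed

lemma Metric_space_d_H: "Metric_space (polydisc :: (complex ^ 'n) set) d_H"
proof
  fix x y z :: "complex ^ 'n"
  show "0 \<le> d_H x y"
  proof (cases "x \<in> polydisc \<and> y \<in> polydisc")
    case True
    then show ?thesis using d_H_greatest H_length_nonneg by blast
  qed (auto simp: d_H_def)
  show "d_H x y = d_H y x"
  proof (cases "x \<in> polydisc \<and> y \<in> polydisc")
    case True
    then show ?thesis by (intro antisym d_H_le_swap) auto
  qed (auto simp: d_H_def)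
  assume x: "x \<in> polydisc" and y: "y \<in> polydisc"
  show "d_H x y = 0 \<longleftrightarrow> x = y"
  proof
    assume "d_H x y = 0"
    then have "norm (y $ j - x $ j) \<le> 0" for j
      using d_H_ge[OF x y, of j] pi_gt_zero by (auto simp: mult_le_0_iff)
    then show "x = y" by (simp add: vec_eq_iff)
  next
    assume "x = y"
    \<comment> \<open>The constant path has derivative 0, and homogeneity with factor 0 makes its
      speed vanish.\<close>
    have "H_length (linepath x x) = 0"
      using H_metric_scaleR[of x 0 0] by (simp add: H_length_def linepath_refl)
    then have "d_H x x \<le> 0" using d_H_le[OF joins_in_polydisc_linepath[OF x x]] by simp
    moreover have "0 \<le> d_H x x" using d_H_greatest[OF x x] H_length_nonneg by blast
    ultimately show "d_H x y = 0" using \<open>x = y\<close> by simp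
  qed
  assume "z \<in> polydisc"
  with x y show "d_H x z \<le> d_H x y + d_H y z" by (intro d_H_triangle)
qed

section \<open>A Cauchy sequence without limit\<close>

lemma sin_in_unit: "0 < \<theta> \<Longrightarrow> \<theta> < pi / 2 \<Longrightarrow> 0 < sin \<theta> \<and> sin \<theta> < 1"
  using sin_monotone_2pi[of \<theta> "pi / 2"] by (simp add: sin_gt_zero2)

lemma sin_diagonal_in_polydisc:
  "0 < \<theta> \<Longrightarrow> \<theta> < pi / 2 \<Longrightarrow> sin \<theta> *\<^sub>R (1 :: complex ^ 'n) \<in> polydisc"
  using sin_in_unit[of \<theta>] by (simp add: polydisc_def)

text \<open>
  Along the diagonal curve with coordinates \<open>sin \<theta>\<close> the bound \<open>M_fun r \<ge> 4/\<pi> sqrt (1 - r\<^sup>2)\<close>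
  cancels the factor \<open>cos \<theta>\<close> of the derivative, so the curve reaches the boundary in finite length.
\<close>

lemma d_H_sin_diagonal_le:
  assumes \<alpha>: "0 < \<alpha>" "\<alpha> < pi / 2" and \<beta>: "0 < \<beta>" "\<beta> < pi / 2"
  shows "d_H (sin \<alpha> *\<^sub>R (1 :: complex ^ 'n)) (sin \<beta> *\<^sub>R 1) \<le> pi / 2 * \<bar>\<beta> - \<alpha>\<bar>"
proof -
  define \<theta> where "\<theta> s = \<alpha> + s * (\<beta> - \<alpha>)" for s
  define \<gamma> where "\<gamma> s = sin (\<theta> s) *\<^sub>R (1 :: complex ^ 'n)" for s
  have \<theta>: "0 < \<theta> s" "\<theta> s < pi / 2" if "s \<in> {0..1}" for s
    using convexD_alt[OF convex_real_interval(8), of \<alpha> 0 "pi / 2" \<beta> s] that \<alpha> \<beta>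
    by (auto simp: \<theta>_def algebra_simps)
  have der: "(\<gamma> has_vector_derivative (cos (\<theta> s) * (\<beta> - \<alpha>)) *\<^sub>R 1) (at s within A)" for s A
    unfolding \<gamma>_def \<theta>_def by (auto intro!: derivative_eq_intros)
  have ch: "C1_chain \<gamma> 0 1"
    by (rule C1_chain_single[OF _ _ der]) (auto simp: \<theta>_def intro!: continuous_intros)
  have join: "joins_in_polydisc (sin \<alpha> *\<^sub>R (1 :: complex ^ 'n)) (sin \<beta> *\<^sub>R 1) \<gamma>"
    using ch by (auto simp: joins_in_polydisc_def \<gamma>_def intro!: sin_diagonal_in_polydisc \<theta>)
       (auto simp: \<theta>_def)
  have "H_length \<gamma> \<le> pi / 2 * \<bar>\<beta> - \<alpha>\<bar>"
  proof (rule has_integral_le[OF joins_in_polydisc_H_length[OF join]])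
    show "((\<lambda>s :: real. pi / 2 * \<bar>\<beta> - \<alpha>\<bar>) has_integral pi / 2 * \<bar>\<beta> - \<alpha>\<bar>) {0..1}"
      using has_integral_const_real[of "pi / 2 * \<bar>\<beta> - \<alpha>\<bar>" 0 1] by simp
    fix s :: real assume s: "s \<in> {0..1}"
    have r: "0 < sin (\<theta> s)" "sin (\<theta> s) < 1" using sin_in_unit \<theta>[OF s] by auto
    have c: "0 < cos (\<theta> s)" using \<theta>[OF s] by (intro cos_gt_zero_pi) auto
    have "sqrt (1 - (sin (\<theta> s))\<^sup>2) = cos (\<theta> s)"
      using c by (simp add: cos_squared_eq[symmetric])
    then have M: "4 / pi * cos (\<theta> s) \<le> M_fun (sin (\<theta> s))"
      using M_fun_ge[of "sin (\<theta> s)"] r by simp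
    have "2 * (cos (\<theta> s) * \<bar>\<beta> - \<alpha>\<bar>) / M_fun (sin (\<theta> s)) \<le> 2 * (cos (\<theta> s) * \<bar>\<beta> - \<alpha>\<bar>) / (4 / pi * cos (\<theta> s))"
      using M c M_fun_pos[of "sin (\<theta> s)"] r by (intro divide_left_mono mult_pos_pos) auto
    also have "\<dots> = pi / 2 * \<bar>\<beta> - \<alpha>\<bar>" using c by simp
    finally show "H_speed \<gamma> s \<le> pi / 2 * \<bar>\<beta> - \<alpha>\<bar>"
      unfolding H_metric_le_iff vector_derivative_at[OF der] \<gamma>_def
      using r c by (simp add: abs_mult)
  qed
  then show ?thesis using d_H_le[OF join] by simp
qed

text \<open>Diagonal points whose angles tend to \<open>pi / 2\<close> form a Cauchy sequence, since
  their distance is at most \<open>pi / 2\<close> times the difference of angles. A limit for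
  \<open>d_H\<close> is also a coordinatewise limit, so its coordinates would equal 1.\<close>

lemma not_mcomplete_d_H: "\<not> Metric_space.mcomplete (polydisc :: (complex ^ 'n) set) d_H"
proof
  interpret Metric_space "polydisc :: (complex ^ 'n) set" d_H by (rule Metric_space_d_H)
  assume complete: mcomplete
  define a :: "nat \<Rightarrow> real" where "a n = inverse (real (Suc n))" for n
  define \<theta> where "\<theta> n = pi / 2 - a n" for n
  have \<theta>: "0 < \<theta> n" "\<theta> n < pi / 2" for n
  proof -
    have "0 < a n" "a n \<le> 1" by (auto simp: a_def inverse_le_1_iff)
    then show "0 < \<theta> n" "\<theta> n < pi / 2" using pi_gt3 by (auto simp: \<theta>_def)
  qed
  have a0: "a \<longlonglongrightarrow> 0" unfolding a_def by (rule LIMSEQ_inverse_real_of_nat)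
  define x :: "nat \<Rightarrow> complex ^ 'n" where "x n = sin (\<theta> n) *\<^sub>R 1" for n
  have xin: "x n \<in> polydisc" for n
    unfolding x_def by (intro sin_diagonal_in_polydisc \<theta>)
  have "MCauchy x"
    unfolding MCauchy_def
  proof (intro conjI allI impI)
    show "range x \<subseteq> polydisc" using xin by auto
    fix \<epsilon> :: real assume "\<epsilon> > 0"
    have "Cauchy a" using a0 by (simp add: LIMSEQ_imp_Cauchy)
    then obtain N where N: "\<And>n m. n \<ge> N \<Longrightarrow> m \<ge> N \<Longrightarrow> \<bar>a n - a m\<bar> < 2 / pi * \<epsilon>"
      using \<open>\<epsilon> > 0\<close> unfolding Cauchy_def dist_real_def
      by (metis divide_pos_pos mult_pos_pos pi_gt_zero zero_less_numeral)
    show "\<exists>N. \<forall>n n'. N \<le> n \<longrightarrow> N \<le> n' \<longrightarrow> d_H (x n) (x n') < \<epsilon>"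
    proof (intro exI[of _ N] allI impI)
      fix n m assume "N \<le> n" "N \<le> m"
      then have "\<bar>\<theta> m - \<theta> n\<bar> < 2 / pi * \<epsilon>" using N[of n m] by (simp add: \<theta>_def)
      then have "pi / 2 * \<bar>\<theta> m - \<theta> n\<bar> < \<epsilon>" by (simp add: field_simps)
      then show "d_H (x n) (x m) < \<epsilon>"
        using d_H_sin_diagonal_le[OF \<theta> \<theta>, of n m, where 'n = 'n] unfolding x_def by linarith
    qed
  qed
  then obtain y where "limitin mtopology x y sequentially"
    using complete by (auto simp: mcomplete_def)
  then have y: "y \<in> polydisc" and lim: "(\<lambda>n. d_H (x n) y) \<longlonglongrightarrow> 0"
    by (auto simp: limitin_metric_dist_null)
  \<comment> \<open>Picks an arbitrary coordinate; index types are nonempty.\<close>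
  obtain j :: 'n where True by blast
  have "(\<lambda>n. x n $ j) \<longlonglongrightarrow> y $ j"
  proof (rule LIM_zero_cancel, rule Lim_null_comparison)
    show "\<forall>\<^sub>F n in sequentially. norm (x n $ j - y $ j) \<le> 2 / pi * d_H (x n) y"
    proof (rule always_eventually, rule allI)
      fix n
      show "norm (x n $ j - y $ j) \<le> 2 / pi * d_H (x n) y"
        using d_H_ge[OF xin[of n] y, of j] by (simp add: field_simps norm_minus_commute)
    qed
    show "(\<lambda>n. 2 / pi * d_H (x n) y) \<longlonglongrightarrow> 0"
      using tendsto_mult_right_zero[OF lim] by blast
  qed
  moreover have "(\<lambda>n. x n $ j) \<longlonglongrightarrow> 1"
  proof -
    have "(\<lambda>n. complex_of_real (sin (\<theta> n))) \<longlonglongrightarrow> of_real (sin (pi / 2 - 0))"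
      unfolding \<theta>_def by (intro tendsto_intros a0)
    then show ?thesis by (simp add: x_def of_real_def)
  qed
  ultimately have "y $ j = 1" by (rule LIMSEQ_unique)
  then show False using y by (auto simp: polydisc_def dest: spec[of _ j])
qed

theorem theorem11p8:
  shows "(\<forall>p \<in> (polydisc :: (complex ^ 'n) set). \<forall>v :: complex ^ 'n. v \<noteq> 0 \<longrightarrow>
            H_metric p v < 2 * kobayashi_royden polydisc p v \<and>
            2 * kobayashi_royden polydisc p v =
              (MAX j. 2 * norm (v $ j) / (1 - (norm (p $ j))\<^sup>2))) \<and>
         Metric_space (polydisc :: (complex ^ 'n) set) d_H \<and>
         \<not> Metric_space.mcomplete (polydisc :: (complex ^ 'n) set) d_H"
  by (simp add: two_kobayashi_royden_polydisc H_metric_less_kobayashi Metric_space_d_H not_mcomplete_d_H)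

end
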